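(* Let $\mathcal{X}$ be an infinite dimensional separable complex Banach space and let $T$ be a bounded linear operator on $\mathcal{X}$. Let $A_T$ and $A_{-T}$ be the bounded linear operators on $\mathcal{X}\times\mathcal{X}$ given by $A_T(x,y)=(y,Tx)$ and $A_{-T}(x,y)=(y,-Tx)$. Then $T$ has a nontrivial closed invariant subspace if and only if $A_T$ and $A_{-T}$ have a common nontrivial closed invariant subspace.
   Context: $\mathcal{X}\times\mathcal{X}$ is the Banach space with norm $\|(x,y)\|=\|x\|+\|y\|$. In block form $A_T=\begin{bmatrix}0&I\\ T&0\end{bmatrix}$. A closed linear subspace is invariant for an operator if the operator maps it into itself; it is nontrivial if it is neither $\{0\}$ nor the whole space. A common nontrivial closed invariant subspace of two operators is a single nontrivial closed subspace invariant under both. *)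

theory Defs
  imports "HOL-Analysis.Analysis"
begin

text \<open>
  The distribution only has real normed spaces. A complex normed space is one whose real scalar
  multiplication is the restriction of a complex one and whose norm is absolutely homogeneous over
  the complex numbers.
\<close>

class complex_normed_vector = real_normed_vector +
  fixes scaleC :: "complex \<Rightarrow> 'a \<Rightarrow> 'a"  (infixr \<open>*\<^sub>C\<close> 75)
  assumes scaleC_add_right: "a *\<^sub>C (x + y) = a *\<^sub>C x + a *\<^sub>C y"
    and scaleC_add_left: "(a + b) *\<^sub>C x = a *\<^sub>C x + b *\<^sub>C x"
    and scaleC_scaleC: "a *\<^sub>C b *\<^sub>C x = (a * b) *\<^sub>C x"
    and scaleC_one: "1 *\<^sub>C x = x"
    and scaleC_of_real: "complex_of_real r *\<^sub>C x = r *\<^sub>R x"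
    and norm_scaleC: "norm (a *\<^sub>C x) = cmod a * norm x"

class complex_banach = complex_normed_vector + complete_space
begin
subclass banach ..
end

global_interpretation complex_vector:
  vector_space "scaleC :: complex \<Rightarrow> 'a \<Rightarrow> 'a::complex_normed_vector"
  by unfold_locales (rule scaleC_add_right scaleC_add_left scaleC_scaleC scaleC_one)+

definition infinite_dimensional :: "'a::complex_normed_vector itself \<Rightarrow> bool"
  where "infinite_dimensional _ \<longleftrightarrow>
    \<not> (\<exists>B :: 'a set. finite B \<and> complex_vector.span B = UNIV)"

definition bounded_clinear ::
    "('a::complex_normed_vector \<Rightarrow> 'b::complex_normed_vector) \<Rightarrow> bool"
  where "bounded_clinear T \<longleftrightarrow>
    Vector_Spaces.linear scaleC scaleC T \<and> (\<exists>K. \<forall>x. norm (T x) \<le> norm x * K)"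

definition nontrivial_closed_subspace :: "'a::complex_normed_vector set \<Rightarrow> bool"
  where "nontrivial_closed_subspace M \<longleftrightarrow>
    complex_vector.subspace M \<and> closed M \<and> M \<noteq> {0} \<and> M \<noteq> UNIV"

definition invariant_under :: "('a \<Rightarrow> 'a) \<Rightarrow> 'a set \<Rightarrow> bool"
  where "invariant_under T M \<longleftrightarrow> T ` M \<subseteq> M"

text \<open>
  The product of two normed spaces with norm \<open>\<parallel>(x, y)\<parallel> = \<parallel>x\<parallel> + \<parallel>y\<parallel>\<close>. It is a type of its own because
  the library equips \<open>'a \<times> 'b\<close> with the Euclidean norm of the pair of norms.
\<close>

datatype ('a, 'b) sum_prod = SPair (sfst: 'a) (ssnd: 'b)

instantiation sum_prod :: (complex_normed_vector, complex_normed_vector) complex_normed_vector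
begin

definition "0 = SPair 0 0"
definition "p + q = SPair (sfst p + sfst q) (ssnd p + ssnd q)"
definition "p - q = SPair (sfst p - sfst q) (ssnd p - ssnd q)"
definition "- p = SPair (- sfst p) (- ssnd p)"
definition "r *\<^sub>R p = SPair (r *\<^sub>R sfst p) (r *\<^sub>R ssnd p)"
definition "c *\<^sub>C p = SPair (c *\<^sub>C sfst p) (c *\<^sub>C ssnd p)"
definition "norm p = norm (sfst p) + norm (ssnd p)"
definition "sgn p = inverse (norm p) *\<^sub>R p" for p :: "('a, 'b) sum_prod"
definition "dist p q = norm (p - q)" for p q :: "('a, 'b) sum_prod"
definition [code del]:
  "uniformity = (INF e\<in>{0 <..}. principal {(p, q :: ('a, 'b) sum_prod). dist p q < e})"
definition [code del]:
  "open U \<longleftrightarrow> (\<forall>p\<in>U. eventually (\<lambda>(p', q). p' = p \<longrightarrow> q \<in> U) uniformity)"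
  for U :: "('a, 'b) sum_prod set"

instance
proof
  fix p q r :: "('a, 'b) sum_prod" and a b :: real and c d :: complex
    and U :: "('a, 'b) sum_prod set"
  note ops = zero_sum_prod_def plus_sum_prod_def minus_sum_prod_def uminus_sum_prod_def
    scaleR_sum_prod_def scaleC_sum_prod_def norm_sum_prod_def
  show "p + q + r = p + (q + r)" "p + q = q + p" "0 + p = p" "- p + p = 0" "p - q = p + - q"
    by (simp_all add: ops)
  show "a *\<^sub>R (p + q) = a *\<^sub>R p + a *\<^sub>R q" "(a + b) *\<^sub>R p = a *\<^sub>R p + b *\<^sub>R p"
    "a *\<^sub>R b *\<^sub>R p = (a * b) *\<^sub>R p" "1 *\<^sub>R p = p"
    by (simp_all add: ops scaleR_add_right scaleR_add_left)
  show "c *\<^sub>C (p + q) = c *\<^sub>C p + c *\<^sub>C q" "(c + d) *\<^sub>C p = c *\<^sub>C p + d *\<^sub>C p"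
    "c *\<^sub>C d *\<^sub>C p = (c * d) *\<^sub>C p" "1 *\<^sub>C p = p" "complex_of_real a *\<^sub>C p = a *\<^sub>R p"
    by (simp_all add: ops scaleC_add_right scaleC_add_left scaleC_scaleC scaleC_one
        scaleC_of_real)
  show "norm p = 0 \<longleftrightarrow> p = 0"
    by (cases p) (simp add: ops add_nonneg_eq_0_iff)
  show "norm (p + q) \<le> norm p + norm q"
    using norm_triangle_ineq[of "sfst p" "sfst q"] norm_triangle_ineq[of "ssnd p" "ssnd q"]
    by (simp add: ops)
  show "norm (a *\<^sub>R p) = \<bar>a\<bar> * norm p" "norm (c *\<^sub>C p) = cmod c * norm p"
    by (simp_all add: ops norm_scaleC distrib_left)
qed (simp_all add: sgn_sum_prod_def dist_sum_prod_def uniformity_sum_prod_def open_sum_prod_def)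

end

instance sum_prod :: (complex_banach, complex_banach) complex_banach
proof
  fix X :: "nat \<Rightarrow> ('a, 'b) sum_prod"
  assume X: "Cauchy X"
  have "Cauchy (\<lambda>n. sfst (X n))" "Cauchy (\<lambda>n. ssnd (X n))"
    using X unfolding Cauchy_iff norm_sum_prod_def minus_sum_prod_def sum_prod.sel
    by (meson add_less_le_mono le_less_trans le_add_same_cancel1 le_add_same_cancel2 norm_ge_zero)+
  then obtain x y where xy: "(\<lambda>n. sfst (X n)) \<longlonglongrightarrow> x" "(\<lambda>n. ssnd (X n)) \<longlonglongrightarrow> y"
    by (meson Cauchy_convergent_iff convergent_def)
  have "(\<lambda>n. norm (sfst (X n) - x) + norm (ssnd (X n) - y)) \<longlonglongrightarrow> 0"
    using tendsto_add[OF tendsto_norm_zero[OF LIM_zero[OF xy(1)]]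
        tendsto_norm_zero[OF LIM_zero[OF xy(2)]]] by simp
  then have "(\<lambda>n. norm (X n - SPair x y)) \<longlonglongrightarrow> 0"
    by (simp add: norm_sum_prod_def minus_sum_prod_def)
  then have "X \<longlonglongrightarrow> SPair x y"
    by (simp add: LIM_zero_iff tendsto_norm_zero_iff)
  then show "convergent X"
    by (auto simp: convergent_def)
qed

definition block_op :: "('a \<Rightarrow> 'a) \<Rightarrow> ('a, 'a) sum_prod \<Rightarrow> ('a, 'a) sum_prod"
  where "block_op T p = SPair (ssnd p) (T (sfst p))"

lemma block_op_SPair: "block_op T (SPair x y) = SPair y (T x)"
  by (simp add: block_op_def)

lemma bounded_clinear_uminus:
  assumes "bounded_clinear T"
  shows "bounded_clinear (\<lambda>x. - T x)"
  using assms by (auto simp: bounded_clinear_def Vector_Spaces.linear_iff)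

lemma bounded_clinear_block_op:
  assumes "bounded_clinear T"
  shows "bounded_clinear (block_op T)"
proof -
  from assms obtain K where lin: "Vector_Spaces.linear scaleC scaleC T"
    and K: "\<And>x. norm (T x) \<le> norm x * K"
    by (auto simp: bounded_clinear_def)
  have "norm (block_op T p) \<le> norm p * (\<bar>K\<bar> + 1)" for p
  proof -
    have "norm (T (sfst p)) \<le> norm (sfst p) * \<bar>K\<bar>"
      using K[of "sfst p"] by (meson abs_ge_self mult_left_mono norm_ge_zero order_trans)
    moreover have "0 \<le> norm (ssnd p) * \<bar>K\<bar>"
      by simp
    ultimately show ?thesis
      using norm_ge_zero[of "sfst p"]
      unfolding block_op_def norm_sum_prod_def sum_prod.sel distrib_left distrib_right mult_1_right
      by linarith
  qed
  moreover have "Vector_Spaces.linear scaleC scaleC (block_op T)"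
    using lin by (simp add: Vector_Spaces.linear_iff block_op_def plus_sum_prod_def
        scaleC_sum_prod_def complex_vector.vector_space_axioms)
  ultimately show ?thesis
    unfolding bounded_clinear_def by blast
qed

end

theory Submission
  imports Defs
begin

text \<open>
  Half the sum and half the difference of \<open>A\<^sub>T\<close> and \<open>A\<^sub>-\<^sub>T\<close> are the matrix units
  \<open>(x, y) \<mapsto> (y, 0)\<close> and \<open>(x, y) \<mapsto> (0, T x)\<close>, so a subspace is invariant under both block
  operators exactly when it is invariant under these two maps.

  If \<open>M\<close> is invariant under \<open>T\<close>, then \<open>M \<times> M\<close> is invariant under both block operators.

  Conversely, let \<open>N\<close> be a nontrivial closed subspace invariant under both, and let
  \<open>H = {x. (x, 0) \<in> N}\<close> and \<open>V = {y. (0, y) \<in> N}\<close> be its slices, which are closed subspaces.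
  From \<open>(x, 0) \<in> N\<close> follows \<open>(0, T x) \<in> N\<close> and then \<open>(T x, 0) \<in> N\<close>, so \<open>H\<close> is invariant
  under \<open>T\<close>. If \<open>H = {0}\<close>, every \<open>(x, y) \<in> N\<close> has \<open>y \<in> H\<close>, so \<open>y = 0\<close>, hence \<open>x \<in> H\<close> and
  \<open>x = 0\<close>: this contradicts \<open>N \<noteq> {0}\<close>. If \<open>H\<close> is the whole space, then \<open>V\<close> contains the range of
  \<open>T\<close> and so is invariant under \<open>T\<close>, and \<open>V\<close> is not the whole space because \<open>N\<close> is not. The
  only way that \<open>V\<close> can still be trivial is \<open>V = {0}\<close>; then \<open>T = 0\<close>, every subspace is invariant,
  and a line is a nontrivial closed one.
\<close>

lemmas sum_prod_ops = zero_sum_prod_def plus_sum_prod_def minus_sum_prod_def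
  scaleR_sum_prod_def scaleC_sum_prod_def norm_sum_prod_def

lemma bounded_linear_sfst: "bounded_linear sfst"
  by (rule bounded_linear_intro[where K = 1]) (simp_all add: sum_prod_ops)

lemma bounded_linear_ssnd: "bounded_linear ssnd"
  by (rule bounded_linear_intro[where K = 1]) (simp_all add: sum_prod_ops)

lemma bounded_linear_SPair_0: "bounded_linear (\<lambda>x. SPair x 0)"
  by (rule bounded_linear_intro[where K = 1]) (simp_all add: sum_prod_ops)

lemma bounded_linear_0_SPair: "bounded_linear (SPair 0)"
  by (rule bounded_linear_intro[where K = 1]) (simp_all add: sum_prod_ops)

lemma closed_vimage_bounded_linear:
  assumes "bounded_linear f" "closed S"
  shows "closed (f -` S)"
  using assms by (simp add: closed_vimage linear_continuous_on)

text \<open>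
  Completeness of the scalar field makes lines closed: when \<open>c\<^sub>n *\<^sub>C v\<close> converges and \<open>v \<noteq> 0\<close>,
  the scalars \<open>c\<^sub>n\<close> form a Cauchy sequence.
\<close>

lemma closed_complex_line: "closed (range (\<lambda>c. c *\<^sub>C v))"
  for v :: "'a::complex_normed_vector"
proof (cases "v = 0")
  case True
  then show ?thesis by (simp add: image_constant_conv)
next
  case False
  have norm_diff: "norm (c *\<^sub>C v - d *\<^sub>C v) = cmod (c - d) * norm v" for c d
    by (metis complex_vector.scale_left_diff_distrib norm_scaleC)
  show ?thesis
    unfolding closed_sequential_limits
  proof (intro allI impI, elim conjE)
    fix X l
    assume "\<forall>n. X n \<in> range (\<lambda>c. c *\<^sub>C v)" and lim: "X \<longlonglongrightarrow> l"
    then have "\<forall>n. \<exists>c. X n = c *\<^sub>C v"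
      by blast
    then obtain c where X: "\<And>n. X n = c n *\<^sub>C v"
      by metis
    have "Cauchy c"
      unfolding Cauchy_iff
    proof (intro allI impI)
      fix e :: real
      assume "0 < e"
      with False have "0 < e * norm v" by simp
      with LIMSEQ_imp_Cauchy[OF lim] obtain K where
        "\<forall>m\<ge>K. \<forall>n\<ge>K. norm (X m - X n) < e * norm v"
        unfolding Cauchy_iff by blast
      with False show "\<exists>K. \<forall>m\<ge>K. \<forall>n\<ge>K. cmod (c m - c n) < e"
        by (auto simp: X norm_diff)
    qed
    then obtain d where "c \<longlonglongrightarrow> d"
      by (auto simp: Cauchy_convergent_iff convergent_def)
    then have "(\<lambda>n. cmod (c n - d) * norm v) \<longlonglongrightarrow> 0"
      by (intro tendsto_mult_left_zero tendsto_norm_zero LIM_zero)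
    then have "(\<lambda>n. X n - d *\<^sub>C v) \<longlonglongrightarrow> 0"
      by (subst tendsto_norm_zero_iff[symmetric]) (simp add: X norm_diff)
    then have "X \<longlonglongrightarrow> d *\<^sub>C v"
      by (rule LIM_zero_cancel)
    with lim have "l = d *\<^sub>C v"
      by (rule LIMSEQ_unique)
    then show "l \<in> range (\<lambda>c. c *\<^sub>C v)" by blast
  qed
qed

lemma ex_nontrivial_closed_subspace:
  assumes "infinite_dimensional TYPE('a::complex_normed_vector)"
  shows "\<exists>M :: 'a set. nontrivial_closed_subspace M"
proof -
  have not_span: "complex_vector.span B \<noteq> (UNIV :: 'a set)" if "finite B" for B
    using assms that by (auto simp: infinite_dimensional_def)
  from not_span[of "{}"] obtain v :: 'a where v: "v \<noteq> 0"
    by auto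
  have "nontrivial_closed_subspace (complex_vector.span {v})"
    unfolding nontrivial_closed_subspace_def
  proof (intro conjI)
    show "closed (complex_vector.span {v})"
      by (simp add: complex_vector.span_singleton closed_complex_line)
    show "complex_vector.span {v} \<noteq> {0}"
      using v complex_vector.span_base[of v "{v}"] by auto
  qed (simp_all add: not_span)
  then show ?thesis by blast
qed

text \<open>
  The two maps on the right are half the sum and half the difference of the block operators; this
  is the only point at which both signs of \<open>T\<close> are used together.
\<close>

lemma invariant_under_both_block_ops_iff:
  assumes N: "complex_vector.subspace N"
  shows "invariant_under (block_op T) N \<and> invariant_under (block_op (\<lambda>x. - T x)) N \<longleftrightarrow>
    (\<forall>x y. SPair x y \<in> N \<longrightarrow> SPair y 0 \<in> N \<and> SPair 0 (T x) \<in> N)"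
    (is "?inv \<longleftrightarrow> ?units")
proof
  assume inv: ?inv
  show ?units
  proof (intro allI impI)
    fix x y
    assume "SPair x y \<in> N"
    with inv have "block_op T (SPair x y) \<in> N" "block_op (\<lambda>x. - T x) (SPair x y) \<in> N"
      unfolding invariant_under_def by blast+
    then have plus: "SPair y (T x) \<in> N" and minus: "SPair y (- T x) \<in> N"
      by (simp_all add: block_op_SPair)
    have half: "(1/2) *\<^sub>C (z + z) = z" for z :: 'a
      using scaleC_add_left[of "1/2" "1/2" z] by (simp add: scaleC_add_right scaleC_one)
    have "SPair y 0 = (1/2) *\<^sub>C (SPair y (T x) + SPair y (- T x))"
      "SPair 0 (T x) = (1/2) *\<^sub>C (SPair y (T x) - SPair y (- T x))"
      by (simp_all add: sum_prod_ops half)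
    then show "SPair y 0 \<in> N \<and> SPair 0 (T x) \<in> N"
      using N plus minus
      by (simp add: complex_vector.subspace_add complex_vector.subspace_diff
          complex_vector.subspace_scale)
  qed
next
  assume units: ?units
  have "block_op T p \<in> N \<and> block_op (\<lambda>x. - T x) p \<in> N" if "p \<in> N" for p
  proof (cases p)
    case (SPair x y)
    with that units have "SPair y 0 \<in> N" "SPair 0 (T x) \<in> N" by auto
    with N have "SPair y 0 + SPair 0 (T x) \<in> N" "SPair y 0 - SPair 0 (T x) \<in> N"
      by (auto intro: complex_vector.subspace_add complex_vector.subspace_diff)
    then show ?thesis
      by (simp add: SPair block_op_SPair sum_prod_ops)
  qed
  then show ?inv
    by (auto simp: invariant_under_def)
qed

theorem theorem3p1:
  fixes T :: "'a::complex_banach \<Rightarrow> 'a"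
  assumes "infinite_dimensional TYPE('a)"
    and "separable_space (euclidean :: 'a topology)"
    and "bounded_clinear T"
  shows "(\<exists>M. nontrivial_closed_subspace M \<and> invariant_under T M) \<longleftrightarrow>
    (\<exists>N. nontrivial_closed_subspace N \<and>
      invariant_under (block_op T) N \<and> invariant_under (block_op (\<lambda>x. - T x)) N)"
proof
  assume "\<exists>M. nontrivial_closed_subspace M \<and> invariant_under T M"
  then obtain M where M: "complex_vector.subspace M" "closed M" "M \<noteq> {0}" "M \<noteq> UNIV"
    and inv: "T ` M \<subseteq> M"
    by (auto simp: nontrivial_closed_subspace_def invariant_under_def)
  define N where "N = sfst -` M \<inter> ssnd -` M"
  have mem: "SPair x y \<in> N \<longleftrightarrow> x \<in> M \<and> y \<in> M" for x y
    by (simp add: N_def)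
  have 0: "0 \<in> M"
    using M(1) by (rule complex_vector.subspace_0)
  have sub: "complex_vector.subspace N"
    using M(1) by (auto simp: complex_vector.subspace_def N_def sum_prod_ops)
  have "closed N"
    unfolding N_def using M(2) bounded_linear_sfst bounded_linear_ssnd
    by (intro closed_Int closed_vimage_bounded_linear)
  moreover obtain x y where "x \<in> M" "x \<noteq> 0" "y \<notin> M"
    using M(3,4) 0 by blast
  then have "N \<noteq> {0}" "N \<noteq> UNIV"
    using mem[of x 0] mem[of y 0] 0 by (auto simp: zero_sum_prod_def)
  moreover have "invariant_under (block_op T) N \<and> invariant_under (block_op (\<lambda>x. - T x)) N"
    unfolding invariant_under_both_block_ops_iff[OF sub] using inv 0 by (auto simp: mem)
  ultimately show "\<exists>N. nontrivial_closed_subspace N \<and>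
      invariant_under (block_op T) N \<and> invariant_under (block_op (\<lambda>x. - T x)) N"
    using sub by (auto simp: nontrivial_closed_subspace_def)
next
  assume "\<exists>N. nontrivial_closed_subspace N \<and>
      invariant_under (block_op T) N \<and> invariant_under (block_op (\<lambda>x. - T x)) N"
  then obtain N where sub: "complex_vector.subspace N" and "closed N"
    and N: "N \<noteq> {0}" "N \<noteq> UNIV"
    and inv: "invariant_under (block_op T) N \<and> invariant_under (block_op (\<lambda>x. - T x)) N"
    by (auto simp: nontrivial_closed_subspace_def)
  have units: "SPair y 0 \<in> N" "SPair 0 (T x) \<in> N" if "SPair x y \<in> N" for x y
    using inv that unfolding invariant_under_both_block_ops_iff[OF sub] by blast+
  define H where "H = (\<lambda>x. SPair x 0) -` N"
  define V where "V = SPair 0 -` N"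
  note add = complex_vector.subspace_add[OF sub] and scale = complex_vector.subspace_scale[OF sub]
  have 0: "SPair 0 0 \<in> N"
    using complex_vector.subspace_0[OF sub] by (simp add: zero_sum_prod_def)
  have H: "complex_vector.subspace H" "closed H" "T ` H \<subseteq> H"
  proof -
    show "complex_vector.subspace H"
      unfolding complex_vector.subspace_def
    proof (intro conjI ballI allI)
      show "0 \<in> H"
        using 0 by (simp add: H_def)
    next
      fix x y assume "x \<in> H" "y \<in> H"
      then show "x + y \<in> H"
        using add[of "SPair x 0" "SPair y 0"] by (simp add: H_def plus_sum_prod_def)
    next
      fix c x assume "x \<in> H"
      then show "c *\<^sub>C x \<in> H"
        using scale[of "SPair x 0" c] by (simp add: H_def scaleC_sum_prod_def)
    qed
    show "closed H"
      unfolding H_def using bounded_linear_SPair_0 \<open>closed N\<close> by (rule closed_vimage_bounded_linear)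
    show "T ` H \<subseteq> H"
      using units(1)[OF units(2)] by (auto simp: H_def)
  qed
  have V: "complex_vector.subspace V" "closed V"
  proof -
    show "complex_vector.subspace V"
      unfolding complex_vector.subspace_def
    proof (intro conjI ballI allI)
      show "0 \<in> V"
        using 0 by (simp add: V_def)
    next
      fix x y assume "x \<in> V" "y \<in> V"
      then show "x + y \<in> V"
        using add[of "SPair 0 x" "SPair 0 y"] by (simp add: V_def plus_sum_prod_def)
    next
      fix c x assume "x \<in> V"
      then show "c *\<^sub>C x \<in> V"
        using scale[of "SPair 0 x" c] by (simp add: V_def scaleC_sum_prod_def)
    qed
    show "closed V"
      unfolding V_def using bounded_linear_0_SPair \<open>closed N\<close> by (rule closed_vimage_bounded_linear)
  qed
  have "H \<noteq> {0}"
  proof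
    assume "H = {0}"
    then have H_zero: "x = 0" if "SPair x 0 \<in> N" for x
      using that by (auto simp: H_def)
    have "p = 0" if "p \<in> N" for p
    proof (cases p)
      case (SPair x y)
      with that units(1) H_zero have "y = 0" by blast
      with SPair that H_zero show ?thesis by (simp add: zero_sum_prod_def)
    qed
    then have "N = {0}"
      using complex_vector.subspace_0[OF sub] by blast
    with N(1) show False by contradiction
  qed
  consider "H \<noteq> UNIV" | "H = UNIV" "V \<noteq> {0}" | "H = UNIV" "V = {0}" by blast
  then show "\<exists>M. nontrivial_closed_subspace M \<and> invariant_under T M"
  proof cases
    case 1
    with H \<open>H \<noteq> {0}\<close> show ?thesis
      unfolding nontrivial_closed_subspace_def invariant_under_def by blast
  next
    case 2
    then have horizontal: "SPair x 0 \<in> N" for x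
      by (auto simp: H_def)
    then have "T ` V \<subseteq> V"
      using units(2) by (auto simp: V_def)
    moreover have "V \<noteq> UNIV"
    proof
      assume "V = UNIV"
      then have "SPair x 0 + SPair 0 y \<in> N" for x y
        using add horizontal by (auto simp: V_def)
      then have "p \<in> N" for p
        by (cases p) (simp add: sum_prod_ops)
      with N(2) show False by blast
    qed
    ultimately show ?thesis
      using 2 V unfolding nontrivial_closed_subspace_def invariant_under_def by blast
  next
    case 3
    then have "T x = 0" for x
      using units(2)[of x 0] by (auto simp: H_def V_def)
    moreover obtain M :: "'a set" where M: "nontrivial_closed_subspace M"
      using ex_nontrivial_closed_subspace[OF assms(1)] by blast
    then have "0 \<in> M"
      unfolding nontrivial_closed_subspace_def by (blast intro: complex_vector.subspace_0)
    ultimately have "invariant_under T M"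
      by (auto simp: invariant_under_def)
    with M show ?thesis by blast
  qed
qed

end
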